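(* Let $E\subseteq\mathscr X$ be any non-empty event and let $\mathscr F$ be any proper filter on $\mathscr X$, with corresponding propositional AD-model $M_{\mathscr F}=\langle\mathscr G_{\geq0}^{\mathscr F};-\mathscr G_{\gtrdot0}^{\mathscr F}\rangle$. Then the revision operator satisfies $$\mathrm R(M_{\mathscr F}\vert E)=\begin{cases}M_{\mathscr F_{\mathscr F\cup\{E\}}}&\text{if }\emptyset\notin\mathscr C_{\mathscr F\cup\{E\}}\\ M_{\mathscr F_{\{E\}}}&\text{otherwise.}\end{cases}$$
   Context: $\mathscr X$ is a non-empty set; $\mathscr G$ is the real linear space of all gambles, i.e. bounded maps $f:\mathscr X\to\mathbb R$; $\mathbb I_B$ is the indicator of $B\subseteq\mathscr X$. $\mathscr G_{\geq0}=\{f:\inf f\geq0\}$, $\mathscr G_{\gtrdot0}=\{f:\inf f>0\}$. For non-empty $B$, $\inf(f\vert B)=\inf\{f(x):x\in B\}$. Sums and negatives of sets of gambles are elementwise (Minkowski). A pair $\langle A_{\mathrm{acc}};A_{\mathrm{rej}}\rangle$ of subsets of $\mathscr G$ is called an assessment $A$; $A_{\mathrm{des}}=A_{\mathrm{acc}}\cap(-A_{\mathrm{rej}})$; equality of assessments is componentwise. A filter on $\mathscr X$ is a non-empty collection of subsets of $\mathscr X$ closed under finite intersections and supersets; it is proper if it does not contain $\emptyset$. For a non-empty $\mathscr A\subseteq\mathscr P(\mathscr X)$: $\mathscr C_{\mathscr A}:=\{\bigcap_{k=1}^nA_k:n\in\mathbb N,n\ge1,A_k\in\mathscr A\}$ and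 $\mathscr F_{\mathscr A}:=\{A\subseteq\mathscr X:\exists B\in\mathscr C_{\mathscr A},\,B\subseteq A\}$. For a proper filter $\mathscr F$: $\mathscr G_{\geq0}^{\mathscr F}:=\{f:\exists B\in\mathscr F,\ \inf(f\vert B)\geq0\}$, $\mathscr G_{\gtrdot0}^{\mathscr F}:=\{f:\exists B\in\mathscr F,\ \inf(f\vert B)>0\}$, and $M_{\mathscr F}:=\langle\mathscr G_{\geq0}^{\mathscr F};-\mathscr G_{\gtrdot0}^{\mathscr F}\rangle$ (for which $(M_{\mathscr F})_{\mathrm{des}}=\mathscr G_{\gtrdot0}^{\mathscr F}$). For $E\subseteq\mathscr X$ and $W\subseteq\mathscr G$: $I_E:=\{f\in\mathscr G:\mathbb I_Ef=0\}$ and $W\Vert E:=\{f\in\mathscr G:\mathbb I_Ef\in W\}$. The revision operator is $$\mathrm R(M\vert E):=\begin{cases}\langle M_{\mathrm{acc}}\Vert E;-(M_{\mathrm{des}}\Vert E\cup(\mathscr G_{\gtrdot0}+M_{\mathrm{acc}}\Vert E))\rangle&\text{if }0\notin M_{\mathrm{acc}}\Vert E+\mathscr G_{\gtrdot0}\\ \langle\mathscr G_{\geq0}+I_E;-(\mathscr G_{\gtrdot0}+I_E)\rangle&\text{if }0\in M_{\mathrm{acc}}\Vert E+\mathscr G_{\gtrdot0}\text{ and }0\notin\mathscr G_{\gtrdot0}+I_E\\ \langle\mathscr G;\mathscr G\rangle&\text{if }0\in\mathscr G_{\gtrdot0}+I_E.\end{cases}$$ *)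

theory Defs
  imports
    "HOL-Analysis.Analysis"
    "HOL-Library.Function_Algebras"
    "HOL-Library.Set_Algebras"
begin

text \<open>
  The non-empty set of the paper is the universe of the type variable \<open>'x\<close>. Arithmetic on gambles
  is pointwise (Function_Algebras) and \<open>A + B\<close> on sets of gambles is the Minkowski sum
  (Set_Algebras). The elementwise negative of a set is \<open>uminus ` A\<close>, because \<open>- A\<close> is
  the complement of \<open>A\<close> in HOL.
\<close>

definition gambles :: "('x \<Rightarrow> real) set"
  where "gambles = {f. bounded (range f)}"

definition nonneg_gambles :: "('x \<Rightarrow> real) set"
  where "nonneg_gambles = {f \<in> gambles. (INF x. f x) \<ge> 0}"

definition pos_gambles :: "('x \<Rightarrow> real) set"
  where "pos_gambles = {f \<in> gambles. (INF x. f x) > 0}"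


subsection \<open>Assessments: pairs of accepted and rejected gambles\<close>

type_synonym 'x assessment = "('x \<Rightarrow> real) set \<times> ('x \<Rightarrow> real) set"

definition acc :: "'x assessment \<Rightarrow> ('x \<Rightarrow> real) set"
  where "acc A = fst A"

definition rej :: "'x assessment \<Rightarrow> ('x \<Rightarrow> real) set"
  where "rej A = snd A"

definition des :: "'x assessment \<Rightarrow> ('x \<Rightarrow> real) set"
  where "des A = acc A \<inter> uminus ` rej A"


subsection \<open>Filters of sets and propositional models\<close>

text \<open>
  Filters are collections of subsets rather than elements of the library type \<open>'x filter\<close>, since
  \<open>\<F> \<union> {E}\<close> below is a collection that need not be a filter.
\<close>

definition set_filter :: "'x set set \<Rightarrow> bool"
  where "set_filter \<F> \<longleftrightarrow>
    \<F> \<noteq> {} \<and> (\<forall>A\<in>\<F>. \<forall>B\<in>\<F>. A \<inter> B \<in> \<F>) \<and> (\<forall>A\<in>\<F>. \<forall>B. A \<subseteq> B \<longrightarrow> B \<in> \<F>)"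

definition proper_set_filter :: "'x set set \<Rightarrow> bool"
  where "proper_set_filter \<F> \<longleftrightarrow> set_filter \<F> \<and> {} \<notin> \<F>"

definition finite_inters :: "'x set set \<Rightarrow> 'x set set"
  where "finite_inters \<A> =
    {(\<Inter>k\<in>{1..n}. A k) | (n :: nat) A. n \<ge> 1 \<and> (\<forall>k\<in>{1..n}. A k \<in> \<A>)}"

definition generated_filter :: "'x set set \<Rightarrow> 'x set set"
  where "generated_filter \<A> = {A. \<exists>B\<in>finite_inters \<A>. B \<subseteq> A}"

text \<open>
  The next three definitions are intended for proper filters, whose members are non-empty, so
  that the infimum is never taken over the empty set (where it is an unspecified real).
\<close>

definition filter_nonneg_gambles :: "'x set set \<Rightarrow> ('x \<Rightarrow> real) set"
  where "filter_nonneg_gambles \<F> = {f \<in> gambles. \<exists>B\<in>\<F>. (INF x\<in>B. f x) \<ge> 0}"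

definition filter_pos_gambles :: "'x set set \<Rightarrow> ('x \<Rightarrow> real) set"
  where "filter_pos_gambles \<F> = {f \<in> gambles. \<exists>B\<in>\<F>. (INF x\<in>B. f x) > 0}"

definition filter_model :: "'x set set \<Rightarrow> 'x assessment"
  where "filter_model \<F> = (filter_nonneg_gambles \<F>, uminus ` filter_pos_gambles \<F>)"


subsection \<open>Revision\<close>

definition vanishing_on :: "'x set \<Rightarrow> ('x \<Rightarrow> real) set"
  where "vanishing_on E = {f \<in> gambles. indicat_real E * f = 0}"

definition conditioned :: "('x \<Rightarrow> real) set \<Rightarrow> 'x set \<Rightarrow> ('x \<Rightarrow> real) set"
    (infix "\<parallel>" 70)
  where "W \<parallel> E = {f \<in> gambles. indicat_real E * f \<in> W}"

text \<open>
  For \<open>0 \<in> acc M\<close> (which holds for every model of a filter) one has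
  \<open>vanishing_on E \<subseteq> acc M \<parallel> E\<close>, so the conditions of the three cases exclude
  each other and the nested conditional is an exact rendering of the case distinction.
\<close>

definition revision :: "'x assessment \<Rightarrow> 'x set \<Rightarrow> 'x assessment"
  where "revision M E =
    (if 0 \<notin> (acc M \<parallel> E) + pos_gambles
     then (acc M \<parallel> E, uminus ` ((des M \<parallel> E) \<union> (pos_gambles + (acc M \<parallel> E))))
     else if 0 \<notin> pos_gambles + vanishing_on E
     then (nonneg_gambles + vanishing_on E, uminus ` (pos_gambles + vanishing_on E))
     else (gambles, gambles))"

end

theory Submission
  imports Defs
begin

text \<open>
  The filter generated by \<open>\<F> \<union> {E}\<close> consists of the supersets of the sets \<open>B \<inter> E\<close> with
  \<open>B \<in> \<F>\<close>, and \<open>indicat_real E * f\<close> is nonnegative on \<open>B\<close> iff \<open>f\<close> is nonnegative on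
  \<open>B \<inter> E\<close>. So conditioning the acceptable gambles on \<open>E\<close> yields those of the generated filter
  as long as all the \<open>B \<inter> E\<close> are non-empty. If some \<open>B \<inter> E\<close> is empty, then the condition
  becomes vacuous, every gamble is acceptable after conditioning, and the revision falls back
  on the filter of supersets of \<open>E\<close>.
\<close>

subsection \<open>Gambles\<close>

lemma gambles_iff: "f \<in> gambles \<longleftrightarrow> (\<exists>c. \<forall>x. \<bar>f x\<bar> \<le> c)"
  by (auto simp: gambles_def bounded_iff)

lemma gambles_const: "(\<lambda>x. c) \<in> gambles"
  by (auto simp: gambles_iff)

lemma gambles_add:
  assumes "f \<in> gambles" "g \<in> gambles"
  shows "f + g \<in> gambles"
proof -
  obtain c d where "\<And>x. \<bar>f x\<bar> \<le> c" "\<And>x. \<bar>g x\<bar> \<le> d"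
    using assms by (auto simp: gambles_iff)
  then have "\<bar>f x + g x\<bar> \<le> c + d" for x
    by (meson abs_triangle_ineq add_mono order_trans)
  then show ?thesis
    by (auto simp: gambles_iff)
qed

lemma gambles_if:
  assumes "f \<in> gambles" "g \<in> gambles"
  shows "(\<lambda>x. if x \<in> S then f x else g x) \<in> gambles"
proof -
  obtain c d where "\<And>x. \<bar>f x\<bar> \<le> c" "\<And>x. \<bar>g x\<bar> \<le> d"
    using assms by (auto simp: gambles_iff)
  then have "\<bar>if x \<in> S then f x else g x\<bar> \<le> max c d" for x
    by (simp add: le_max_iff_disj)
  then show ?thesis
    unfolding gambles_iff by blast
qed

lemma indicator_mult_eq_if: "indicat_real E * f = (\<lambda>x. if x \<in> E then f x else 0)"
  by (auto simp: fun_eq_iff indicator_def)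

lemma gambles_indicator_mult:
  assumes "f \<in> gambles"
  shows "indicat_real E * f \<in> gambles"
  unfolding indicator_mult_eq_if using assms by (intro gambles_if gambles_const)

lemma gambles_add_const: "f \<in> gambles \<Longrightarrow> (\<lambda>x. f x + c) \<in> gambles"
  using gambles_add[OF _ gambles_const, of f c] by (simp add: plus_fun_def)

section \<open>Infima expressed through lower bounds\<close>

lemma le_INF_gamble_iff:
  assumes "f \<in> gambles" "B \<noteq> {}"
  shows "c \<le> (INF x\<in>B. f x) \<longleftrightarrow> (\<forall>x\<in>B. c \<le> f x)"
proof (rule le_cINF_iff)
  obtain d where "\<And>x. \<bar>f x\<bar> \<le> d"
    using assms by (auto simp: gambles_iff)
  then show "bdd_below (f ` B)"
    by (intro bdd_belowI2[of _ "- d"]) (simp add: abs_le_iff minus_le_iff)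
qed fact

text \<open>The infimum itself serves as \<open>e\<close>. Pointwise positivity would be too weak,
  since the infimum need not be attained.\<close>

lemma INF_gamble_pos_iff:
  assumes "f \<in> gambles" "B \<noteq> {}"
  shows "0 < (INF x\<in>B. f x) \<longleftrightarrow> (\<exists>e>0. \<forall>x\<in>B. e \<le> f x)"
  using le_INF_gamble_iff[OF assms] by (meson order_refl order_less_le_trans)

lemma nonneg_gambles_eq: "nonneg_gambles = {f \<in> gambles. \<forall>x. 0 \<le> f x}"
  by (auto simp: nonneg_gambles_def le_INF_gamble_iff)

lemma pos_gambles_eq: "pos_gambles = {f \<in> gambles. \<exists>e>0. \<forall>x. e \<le> f x}"
  by (auto simp: pos_gambles_def INF_gamble_pos_iff)

text \<open>Excluding the empty set from \<open>\<F>\<close> keeps the unspecified value of an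
  infimum over \<open>{}\<close> out of play.\<close>

lemma filter_nonneg_gambles_eq:
  assumes "{} \<notin> \<F>"
  shows "filter_nonneg_gambles \<F> = {f \<in> gambles. \<exists>B\<in>\<F>. \<forall>x\<in>B. 0 \<le> f x}"
proof -
  have "(INF x\<in>B. f x) \<ge> 0 \<longleftrightarrow> (\<forall>x\<in>B. 0 \<le> f x)" if "f \<in> gambles" "B \<in> \<F>"
    for f :: "'a \<Rightarrow> real" and B
    using that assms by (intro le_INF_gamble_iff) auto
  then show ?thesis
    by (auto simp: filter_nonneg_gambles_def)
qed

lemma filter_pos_gambles_eq:
  assumes "{} \<notin> \<F>"
  shows "filter_pos_gambles \<F> = {f \<in> gambles. \<exists>B\<in>\<F>. \<exists>e>0. \<forall>x\<in>B. e \<le> f x}"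
proof -
  have "(INF x\<in>B. f x) > 0 \<longleftrightarrow> (\<exists>e>0. \<forall>x\<in>B. e \<le> f x)" if "f \<in> gambles" "B \<in> \<F>"
    for f :: "'a \<Rightarrow> real" and B
    using that assms by (intro INF_gamble_pos_iff) auto
  then show ?thesis
    unfolding filter_pos_gambles_def by blast
qed

lemma acc_filter_model: "acc (filter_model \<F>) = filter_nonneg_gambles \<F>"
  by (simp add: acc_def filter_model_def)

text \<open>The two negations cancel, and a set with positive infimum also witnesses nonnegativity,
  so the intersection is its smaller part.\<close>

lemma des_filter_model: "des (filter_model \<F>) = filter_pos_gambles \<F>"
proof -
  have "filter_pos_gambles \<F> \<subseteq> filter_nonneg_gambles \<F>"
    unfolding filter_nonneg_gambles_def filter_pos_gambles_def using less_imp_le by blast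
  then show ?thesis
    by (auto simp: des_def acc_def rej_def filter_model_def image_image)
qed

subsection \<open>Generated filters\<close>

text \<open>The factors taken from \<open>\<F>\<close> intersect to a member \<open>B\<close> of
  \<open>\<F>\<close>; every other factor is \<open>E\<close> itself.\<close>

lemma finite_inters_insert_subset:
  assumes "set_filter \<F>" "X \<in> finite_inters (\<F> \<union> {E})"
  obtains B where "B \<in> \<F>" "B \<inter> E \<subseteq> X"
proof -
  have "\<exists>B\<in>\<F>. B \<inter> E \<subseteq> (\<Inter>k\<in>{1..n}. A k)" if "\<forall>k\<in>{1..n}. A k \<in> \<F> \<union> {E}"
    for n :: nat and A
    using that
  proof (induction n)
    \<comment> \<open>The empty intersection is \<open>UNIV\<close>, so any member of the non-empty
      \<open>\<F>\<close> will do. Starting at 0 instead of 1 leaves all work on factors to the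
      induction step.\<close>
    case 0
    then show ?case
      using assms(1) by (auto simp: set_filter_def)
  next
    case (Suc n)
    then obtain B where B: "B \<in> \<F>" "B \<inter> E \<subseteq> (\<Inter>k\<in>{1..n}. A k)"
      by auto
    have eq: "(\<Inter>k\<in>{1..Suc n}. A k) = (\<Inter>k\<in>{1..n}. A k) \<inter> A (Suc n)"
      by (simp add: atLeastAtMostSuc_conv Int_commute)
    have "A (Suc n) \<in> \<F> \<union> {E}"
      using Suc.prems by simp
    then consider "A (Suc n) \<in> \<F>" | "A (Suc n) = E"
      by auto
    then show ?case
    proof cases
      case 1
      then have "B \<inter> A (Suc n) \<in> \<F>"
        using assms(1) B(1) by (auto simp: set_filter_def)
      then show ?thesis
        unfolding eq by (rule bexI[rotated]) (use B(2) in blast)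
    next
      \<comment> \<open>A factor \<open>E\<close> already contains \<open>B \<inter> E\<close>, so
        \<open>B\<close> is kept.\<close>
      case 2
      then show ?thesis
        unfolding eq using B by blast
    qed
  qed
  then show thesis
    using assms(2) that unfolding finite_inters_def by blast
qed

lemma Int_in_finite_inters:
  assumes "A \<in> \<A>" "B \<in> \<A>"
  shows "A \<inter> B \<in> finite_inters \<A>"
proof -
  define C where "C k = (if k = 1 then A else B)" for k :: nat
  have "{1..2::nat} = {1, 2}"
    by auto
  then have "A \<inter> B = (\<Inter>k\<in>{1..2}. C k)" "\<forall>k\<in>{1..2}. C k \<in> \<A>"
    using assms by (auto simp: C_def)
  then show ?thesis
    unfolding finite_inters_def by (intro CollectI exI[of _ 2] exI[of _ C]) simp
qed

lemma empty_in_finite_inters_iff: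
  assumes "set_filter \<F>"
  shows "{} \<in> finite_inters (\<F> \<union> {E}) \<longleftrightarrow> (\<exists>B\<in>\<F>. B \<inter> E = {})"
proof
  assume "{} \<in> finite_inters (\<F> \<union> {E})"
  with assms show "\<exists>B\<in>\<F>. B \<inter> E = {}"
    by (elim finite_inters_insert_subset) auto
next
  assume "\<exists>B\<in>\<F>. B \<inter> E = {}"
  then obtain B where B: "B \<in> \<F>" "B \<inter> E = {}"
    by blast
  then have "B \<inter> E \<in> finite_inters (\<F> \<union> {E})"
    by (intro Int_in_finite_inters) auto
  with B show "{} \<in> finite_inters (\<F> \<union> {E})"
    by simp
qed

lemma generated_filter_insert:
  assumes "set_filter \<F>"
  shows "generated_filter (\<F> \<union> {E}) = {A. \<exists>B\<in>\<F>. B \<inter> E \<subseteq> A}"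
proof (intro set_eqI iffI)
  fix A assume "A \<in> generated_filter (\<F> \<union> {E})"
  then obtain X where "X \<in> finite_inters (\<F> \<union> {E})" "X \<subseteq> A"
    by (auto simp: generated_filter_def)
  with assms show "A \<in> {A. \<exists>B\<in>\<F>. B \<inter> E \<subseteq> A}"
    by (elim finite_inters_insert_subset) auto
next
  fix A assume "A \<in> {A. \<exists>B\<in>\<F>. B \<inter> E \<subseteq> A}"
  then show "A \<in> generated_filter (\<F> \<union> {E})"
    using Int_in_finite_inters[of _ "\<F> \<union> {E}" E] by (auto simp: generated_filter_def)
qed

lemma generated_filter_singleton: "generated_filter {E} = {A. E \<subseteq> A}"
proof -
  have "E \<in> finite_inters {E}"
    using Int_in_finite_inters[of E "{E}" E] by simp
  moreover have "E \<subseteq> X" if "X \<in> finite_inters {E}" for X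
    using that by (auto simp: finite_inters_def)
  ultimately show ?thesis
    by (auto simp: generated_filter_def)
qed

subsection \<open>Conditioning\<close>

text \<open>Off \<open>E\<close> the product \<open>indicat_real E * f\<close> is 0, which still
  satisfies \<open>0 \<le>\<close>, so only \<open>B \<inter> E\<close> constrains \<open>f\<close>.
  A bound \<open>e > 0\<close> would fail at points of \<open>B\<close> off
  \<open>E\<close>.\<close>

lemma conditioned_filter_nonneg:
  assumes "{} \<notin> \<F>"
  shows "filter_nonneg_gambles \<F> \<parallel> E = {f \<in> gambles. \<exists>B\<in>\<F>. \<forall>x\<in>B \<inter> E. 0 \<le> f x}"
proof -
  have "(\<forall>x\<in>B. 0 \<le> (indicat_real E * f) x) \<longleftrightarrow> (\<forall>x\<in>B \<inter> E. 0 \<le> f x)" for B and f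
    by (auto simp: indicator_mult_eq_if)
  then show ?thesis
    using assms
    by (auto simp: conditioned_def filter_nonneg_gambles_eq gambles_indicator_mult)
qed

lemma pos_add_conditioned_filter_nonneg:
  assumes "{} \<notin> \<F>"
  shows "pos_gambles + (filter_nonneg_gambles \<F> \<parallel> E) =
    {f \<in> gambles. \<exists>B\<in>\<F>. \<exists>e>0. \<forall>x\<in>B \<inter> E. e \<le> f x}" (is "?L = ?R")
proof (intro set_eqI iffI)
  fix f assume "f \<in> ?L"
  then obtain p g B e where f: "f = p + g" and "p \<in> gambles" "g \<in> gambles"
    and B: "B \<in> \<F>" "\<forall>x\<in>B \<inter> E. 0 \<le> g x" and e: "e > 0" "\<forall>x. e \<le> p x"
    unfolding conditioned_filter_nonneg[OF assms] pos_gambles_eq by (auto elim!: set_plus_elim)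
  moreover have "\<forall>x\<in>B \<inter> E. e \<le> f x"
    using B(2) e(2) f by (simp add: add_increasing2)
  ultimately show "f \<in> ?R"
    using gambles_add by blast
next
  fix f assume "f \<in> ?R"
  then obtain B e where f: "f \<in> gambles" "B \<in> \<F>" "e > 0" "\<forall>x\<in>B \<inter> E. e \<le> f x"
    by auto
  \<comment> \<open>The uniform bound \<open>e\<close> is split off as a constant gamble; the
    remainder is still nonnegative on \<open>B \<inter> E\<close>.\<close>
  have "(\<lambda>x. e) \<in> pos_gambles"
    using f(3) by (auto simp: pos_gambles_eq gambles_const)
  moreover have "(\<lambda>x. f x + - e) \<in> filter_nonneg_gambles \<F> \<parallel> E"
    unfolding conditioned_filter_nonneg[OF assms]
    using f gambles_add_const[of f "- e"] by auto
  moreover have "f = (\<lambda>x. e) + (\<lambda>x. f x + - e)"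
    by (simp add: fun_eq_iff)
  ultimately show "f \<in> ?L"
    by (elim ssubst) (rule set_plus_intro)
qed

text \<open>This makes the conditioned desirable gambles redundant in the union in the first case of
  \<open>revision\<close>. A uniform bound on \<open>B\<close> for the product is one for
  \<open>f\<close> on \<open>B \<inter> E\<close>.\<close>

lemma conditioned_filter_pos_subset:
  assumes "{} \<notin> \<F>"
  shows "filter_pos_gambles \<F> \<parallel> E \<subseteq> pos_gambles + (filter_nonneg_gambles \<F> \<parallel> E)"
proof
  fix f assume "f \<in> filter_pos_gambles \<F> \<parallel> E"
  then obtain B e where "f \<in> gambles" "B \<in> \<F>" "e > 0"
    and le: "\<forall>x\<in>B. e \<le> (indicat_real E * f) x"
    using assms by (auto simp: conditioned_def filter_pos_gambles_eq)
  moreover have "\<forall>x\<in>B \<inter> E. e \<le> f x"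
    using le by (auto simp: indicator_mult_eq_if)
  ultimately show "f \<in> pos_gambles + (filter_nonneg_gambles \<F> \<parallel> E)"
    using assms by (auto simp: pos_add_conditioned_filter_nonneg)
qed

section \<open>Gambles constrained only on \<open>E\<close>\<close>

lemma vanishing_on_eq: "vanishing_on E = {f \<in> gambles. \<forall>x\<in>E. f x = 0}"
  by (auto simp: vanishing_on_def indicator_mult_eq_if fun_eq_iff)

lemma nonneg_add_vanishing_on:
  "nonneg_gambles + vanishing_on E = {f \<in> gambles. \<forall>x\<in>E. 0 \<le> f x}" (is "?L = ?R")
proof (intro set_eqI iffI)
  fix f assume "f \<in> ?L"
  then show "f \<in> ?R"
    by (auto simp: nonneg_gambles_eq vanishing_on_eq gambles_add elim!: set_plus_elim)
next
  fix f assume f: "f \<in> ?R"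
  \<comment> \<open>The possibly negative values off \<open>E\<close> are moved into the part
    vanishing on \<open>E\<close>.\<close>
  let ?p = "\<lambda>x. if x \<in> E then f x else 0" and ?g = "\<lambda>x. if x \<in> E then 0 else f x"
  have "?p \<in> nonneg_gambles" "?g \<in> vanishing_on E"
    using f by (auto simp: nonneg_gambles_eq vanishing_on_eq intro!: gambles_if gambles_const)
  moreover have "f = ?p + ?g"
    by (auto simp: fun_eq_iff)
  ultimately show "f \<in> ?L"
    by (elim ssubst) (rule set_plus_intro)
qed

lemma pos_add_vanishing_on:
  "pos_gambles + vanishing_on E = {f \<in> gambles. \<exists>e>0. \<forall>x\<in>E. e \<le> f x}" (is "?L = ?R")
proof (intro set_eqI iffI)
  fix f assume "f \<in> ?L"
  then obtain p g where "f = p + g" "p \<in> pos_gambles" "g \<in> vanishing_on E"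
    by (auto elim: set_plus_elim)
  then show "f \<in> ?R"
    by (auto simp: pos_gambles_eq vanishing_on_eq gambles_add)
next
  fix f assume "f \<in> ?R"
  then obtain e where f: "f \<in> gambles" "e > 0" "\<forall>x\<in>E. e \<le> f x"
    by auto
  \<comment> \<open>Extending by 0 would lose uniform positivity, so \<open>?p\<close> takes the
    value \<open>e\<close> off \<open>E\<close> and \<open>?g\<close> compensates there.\<close>
  let ?p = "\<lambda>x. if x \<in> E then f x else e" and ?g = "\<lambda>x. if x \<in> E then 0 else f x + - e"
  have "?p \<in> gambles" "?g \<in> gambles"
    using f(1) by (intro gambles_if gambles_add_const gambles_const; assumption)+
  moreover have "\<forall>x. e \<le> ?p x"
    using f(3) by simp
  ultimately have "?p \<in> pos_gambles" "?g \<in> vanishing_on E"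
    using f(2) unfolding pos_gambles_eq vanishing_on_eq by (blast, simp)
  moreover have "f = ?p + ?g"
    by (auto simp: fun_eq_iff)
  ultimately show "f \<in> ?L"
    by (elim ssubst) (rule set_plus_intro)
qed

section \<open>Models of the two generated filters\<close>

lemma filter_model_generated_singleton:
  assumes "E \<noteq> {}"
  shows "filter_model (generated_filter {E}) =
    (nonneg_gambles + vanishing_on E, uminus ` (pos_gambles + vanishing_on E))"
proof -
  have "{} \<notin> generated_filter {E}"
    using assms by (simp add: generated_filter_singleton)
  \<comment> \<open>\<open>E\<close> is the least member of the generated filter, so a lower bound
    on some member is a lower bound on \<open>E\<close>.\<close>
  then have "filter_nonneg_gambles (generated_filter {E}) = nonneg_gambles + vanishing_on E"
    "filter_pos_gambles (generated_filter {E}) = pos_gambles + vanishing_on E"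
    unfolding nonneg_add_vanishing_on pos_add_vanishing_on
    by (auto simp: filter_nonneg_gambles_eq filter_pos_gambles_eq generated_filter_singleton)
  then show ?thesis
    by (simp add: filter_model_def)
qed

lemma filter_model_generated_insert:
  assumes "proper_set_filter \<F>" "\<forall>B\<in>\<F>. B \<inter> E \<noteq> {}"
  shows "filter_model (generated_filter (\<F> \<union> {E})) =
    (filter_nonneg_gambles \<F> \<parallel> E, uminus ` (pos_gambles + (filter_nonneg_gambles \<F> \<parallel> E)))"
proof -
  have \<F>: "set_filter \<F>" "{} \<notin> \<F>"
    using assms(1) by (auto simp: proper_set_filter_def)
  \<comment> \<open>Each member contains some \<open>B \<inter> E\<close>, which is non-empty by
    assumption; hence infima over members are genuine.\<close>
  have "{} \<notin> generated_filter (\<F> \<union> {E})"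
    using assms(2) unfolding generated_filter_insert[OF \<F>(1)] by simp
  note eqs = filter_nonneg_gambles_eq[OF this] filter_pos_gambles_eq[OF this]
  have "filter_nonneg_gambles (generated_filter (\<F> \<union> {E})) = filter_nonneg_gambles \<F> \<parallel> E"
    unfolding eqs
    unfolding conditioned_filter_nonneg[OF \<F>(2)] generated_filter_insert[OF \<F>(1)]
    by blast
  moreover have "filter_pos_gambles (generated_filter (\<F> \<union> {E})) =
      pos_gambles + (filter_nonneg_gambles \<F> \<parallel> E)"
    unfolding eqs
    unfolding pos_add_conditioned_filter_nonneg[OF \<F>(2)] generated_filter_insert[OF \<F>(1)]
    by blast
  ultimately show ?thesis
    by (simp add: filter_model_def)
qed

theorem proposition14:
  fixes E :: "'x set" and \<F> :: "'x set set"
  assumes "E \<noteq> {}" and "proper_set_filter \<F>"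
  shows "revision (filter_model \<F>) E =
    (if {} \<notin> finite_inters (\<F> \<union> {E})
     then filter_model (generated_filter (\<F> \<union> {E}))
     else filter_model (generated_filter {E}))"
proof -
  have \<F>: "set_filter \<F>" "{} \<notin> \<F>"
    using assms(2) by (auto simp: proper_set_filter_def)
  note empty_iff = empty_in_finite_inters_iff[OF \<F>(1), of E]
  \<comment> \<open>The zero gamble has a lower bound \<open>e > 0\<close> on
    \<open>B \<inter> E\<close> only vacuously, and then \<open>e = 1\<close> serves. So the first
    case of \<open>revision\<close> is exactly the consistent case.\<close>
  have "0 \<in> (filter_nonneg_gambles \<F> \<parallel> E) + pos_gambles \<longleftrightarrow> (\<exists>B\<in>\<F>. B \<inter> E = {})"
    unfolding add.commute[of _ pos_gambles] pos_add_conditioned_filter_nonneg[OF \<F>(2)]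
    using gambles_const[of 0] by (auto simp: zero_fun_def not_le intro: zero_less_one)
  then have zero_iff: "0 \<in> (filter_nonneg_gambles \<F> \<parallel> E) + pos_gambles \<longleftrightarrow>
      {} \<in> finite_inters (\<F> \<union> {E})"
    using empty_iff by simp
  \<comment> \<open>At any point of the non-empty \<open>E\<close> the zero gamble violates
    \<open>e \<le> 0\<close>; this rules out the third case of \<open>revision\<close>.\<close>
  have "0 \<notin> pos_gambles + vanishing_on E"
    using assms(1) unfolding pos_add_vanishing_on by (auto simp: not_le)
  moreover have "(filter_pos_gambles \<F> \<parallel> E) \<union> (pos_gambles + (filter_nonneg_gambles \<F> \<parallel> E)) =
      pos_gambles + (filter_nonneg_gambles \<F> \<parallel> E)"
    using conditioned_filter_pos_subset[OF \<F>(2)] by blast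
  ultimately show ?thesis
    using filter_model_generated_insert[OF assms(2), of E] empty_iff
    by (simp add: revision_def acc_filter_model des_filter_model zero_iff
        filter_model_generated_singleton[OF assms(1)])
qed

end
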